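(* Let $X$ be a set, let $0<\alpha<1$ and $c\ge0$, and let $\Delta:X\times X\to[0,\infty)$ be an $\alpha$-$c$ interpolative metric on $X$. Then $\Delta$ is a $b$-metric on $X$.
   Context: A semi-metric on a set $X$ is a function $\Delta:X\times X\to[0,\infty)$ with $\Delta(x,y)=0$ if and only if $x=y$, and $\Delta(x,y)=\Delta(y,x)$ for all $x,y\in X$. For $\alpha\in(0,1)$ and $c\ge0$, a semi-metric $\Delta$ is an $\alpha$-$c$ interpolative metric if for all $x,y,z\in X$, $\Delta(x,y)\le\Delta(x,z)+\Delta(z,y)+c\,\Delta(x,z)^{\alpha}\,\Delta(z,y)^{1-\alpha}$. A semi-metric $\Delta$ is a $b$-metric if there exists a constant $s\ge1$ such that for all $x,y,z\in X$, $\Delta(x,y)\le s(\Delta(x,z)+\Delta(z,y))$. *)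

theory Defs
  imports Complex_Main
begin

definition semi_metric_on :: "'a set \<Rightarrow> ('a \<Rightarrow> 'a \<Rightarrow> real) \<Rightarrow> bool" where
  "semi_metric_on X \<Delta> \<longleftrightarrow>
     (\<forall>x\<in>X. \<forall>y\<in>X. 0 \<le> \<Delta> x y) \<and>
     (\<forall>x\<in>X. \<forall>y\<in>X. \<Delta> x y = 0 \<longleftrightarrow> x = y) \<and>
     (\<forall>x\<in>X. \<forall>y\<in>X. \<Delta> x y = \<Delta> y x)"

text \<open>
  Both exponents are positive for \<open>\<alpha>\<close> in the open unit interval, so the library
  convention \<open>0 powr a = 0\<close> agrees with the usual meaning of the powers at distance zero.
\<close>

definition interpolative_metric_on ::
    "real \<Rightarrow> real \<Rightarrow> 'a set \<Rightarrow> ('a \<Rightarrow> 'a \<Rightarrow> real) \<Rightarrow> bool" where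
  "interpolative_metric_on \<alpha> c X \<Delta> \<longleftrightarrow>
     semi_metric_on X \<Delta> \<and>
     (\<forall>x\<in>X. \<forall>y\<in>X. \<forall>z\<in>X.
        \<Delta> x y \<le> \<Delta> x z + \<Delta> z y + c * (\<Delta> x z powr \<alpha>) * (\<Delta> z y powr (1 - \<alpha>)))"

definition b_metric_on :: "'a set \<Rightarrow> ('a \<Rightarrow> 'a \<Rightarrow> real) \<Rightarrow> bool" where
  "b_metric_on X \<Delta> \<longleftrightarrow>
     semi_metric_on X \<Delta> \<and>
     (\<exists>s\<ge>1. \<forall>x\<in>X. \<forall>y\<in>X. \<forall>z\<in>X. \<Delta> x y \<le> s * (\<Delta> x z + \<Delta> z y))"

end

theory Submission
  imports Defs
begin

text \<open>The interpolation term is a weighted geometric mean of the two distances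
  \<open>\<Delta> x z\<close> and \<open>\<Delta> z y\<close>, hence at most their sum. It therefore
  costs at most \<open>c\<close> times that sum, and the interpolative inequality becomes a relaxed
  triangle inequality. The lemma here is this bound on the mean.\<close>

lemma powr_mult_powr_compl_le_add:
  fixes a b \<alpha> :: real
  assumes "0 \<le> a" "0 \<le> b" "0 \<le> \<alpha>" "\<alpha> \<le> 1"
  shows "a powr \<alpha> * b powr (1 - \<alpha>) \<le> a + b"
proof -
  \<comment> \<open>Both bases are raised to \<open>a + b\<close>, by monotonicity of powers with
    nonnegative exponent; this is cruder than weighted AM-GM but avoids convexity.\<close>
  have "a powr \<alpha> * b powr (1 - \<alpha>) \<le> (a + b) powr \<alpha> * (a + b) powr (1 - \<alpha>)"
    using assms by (intro mult_mono powr_mono2) auto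
  also have "\<dots> = a + b"
    \<comment> \<open>The exponents add up to 1; the case \<open>a + b = 0\<close> is covered
      because \<open>0 powr 1 = 0\<close>.\<close>
    using assms by (simp flip: powr_add)
  finally show ?thesis .
qed

theorem lemma1:
  fixes X :: "'a set" and \<Delta> :: "'a \<Rightarrow> 'a \<Rightarrow> real" and \<alpha> c :: real
  assumes "0 < \<alpha>" and "\<alpha> < 1" and "0 \<le> c"
    and "interpolative_metric_on \<alpha> c X \<Delta>"
  shows "b_metric_on X \<Delta>"
proof -
  have interp: "\<Delta> x y \<le> \<Delta> x z + \<Delta> z y + c * (\<Delta> x z powr \<alpha>) * (\<Delta> z y powr (1 - \<alpha>))"
    if "x \<in> X" "y \<in> X" "z \<in> X" for x y z
    using assms(4) that unfolding interpolative_metric_on_def by blast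
  have semi: "semi_metric_on X \<Delta>"
    using assms(4) unfolding interpolative_metric_on_def by blast
  \<comment> \<open>The witness is \<open>s = 1 + c\<close>: 1 from the plain sum of distances,
    \<open>c\<close> from the bounded interpolation term.\<close>
  have "\<Delta> x y \<le> (1 + c) * (\<Delta> x z + \<Delta> z y)" if "x \<in> X" "y \<in> X" "z \<in> X" for x y z
  proof -
    have "0 \<le> \<Delta> x z" "0 \<le> \<Delta> z y"
      using semi that unfolding semi_metric_on_def by blast+
    then have "c * (\<Delta> x z powr \<alpha> * \<Delta> z y powr (1 - \<alpha>)) \<le> c * (\<Delta> x z + \<Delta> z y)"
      using assms(1-3) by (intro mult_left_mono powr_mult_powr_compl_le_add) auto
    with interp[OF that] show ?thesis
      by (simp add: algebra_simps)
  qed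
  moreover have "1 \<le> 1 + c"
    using assms(3) by simp
  ultimately show ?thesis
    using semi unfolding b_metric_on_def by blast
qed

end
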